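(* Let $(\mathfrak{g}_{4,1}^s,B)$ be the complex quadratic Lie superalgebra with even basis $X_0,X_1$, odd basis $Y_1,Y_2$, $B(X_0,X_1)=B(Y_2,Y_1)=1$ and non-trivial brackets $[X_1,Y_1]=-[Y_1,X_1]=-2Y_2$, $[Y_1,Y_1]=-2X_0$, endowed with a symplectic structure $\omega(X_0,X_1)=2b_1'$, $\omega(Y_2,Y_1)=-b_1'$, $\omega(Y_1,Y_1)=b_2'$ with $b_1',b_2'\in\mathbb{C}$, $b_1'\ne 0$. Let $D$ be an even nilpotent skew-supersymmetric superderivation of $(\mathfrak{g}_{4,1}^s,B)$ and let $(\mathfrak{g},\widetilde{B})$ be the double extension of $(\mathfrak{g}_{4,1}^s,B)$ by the one-dimensional Lie algebra $(\mathbb{C}e)_{\bar 0}$ by means of $D$. Then $(\mathfrak{g},\widetilde{B})$ admits a symplectic structure $\widetilde\omega$, so that $(\mathfrak{g},\widetilde{B},\widetilde{\omega})$ is a quadratic symplectic Lie superalgebra, and $(\mathfrak g,\widetilde B)$ is i-isomorphic to a member of the following family, with respect to the basis $X_0,X_1,e,e^*$ (even) and $Y_1,Y_2$ (odd): $$[e,Y_1]=-[Y_1,e]=b_2Y_2,\qquad [X_1,Y_1]=-[Y_1,X_1]=-2Y_2,\qquad [Y_1,Y_1]=-2X_0+b_2e^*,$$ where $b_2\in\mathbb{C}$ is a non-zero parameter (and the invariant scalar product is $\widetilde{B}(X_0,X_1)=\widetilde{B}(Y_2,Y_1)=\widetilde{B}(e^*,e)=1$). Moreover, the symplectic structure can be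 taken to be $\widetilde{\omega}(X,Y)=\widetilde{B}(\delta(X),Y)$, where $\delta$ is the even invertible skew-supersymmetric superderivation of $(\mathfrak{g},\widetilde{B})$ given in the ordered basis $(X_0,X_1,e,e^*,Y_1,Y_2)$ by the matrix $$2E^{1,1}-2E^{2,2}-2E^{3,3}+2E^{4,4}+E^{5,5}-E^{6,6}.$$
   Context: A Lie superalgebra is a $\mathbb{Z}_2$-graded vector space $\mathfrak{g}=\mathfrak{g}_{\bar 0}\oplus\mathfrak{g}_{\bar 1}$ with an even bilinear bracket satisfying, for homogeneous $X,Y,Z$ of degrees $x,y,z$, $[X,Y]=-(-1)^{xy}[Y,X]$ and $(-1)^{xz}[X,[Y,Z]]+(-1)^{xy}[Y,[Z,X]]+(-1)^{yz}[Z,[X,Y]]=0$. A bilinear form $F$ is even if $F(\mathfrak{g}_{\bar 0},\mathfrak{g}_{\bar 1})=F(\mathfrak{g}_{\bar 1},\mathfrak{g}_{\bar 0})=\{0\}$. $(\mathfrak{g},B)$ is quadratic if $B$ is an even, non-degenerate, supersymmetric ($B(X,Y)=(-1)^{xy}B(Y,X)$), invariant ($B([X,Y],Z)=B(X,[Y,Z])$) bilinear form (an invariant scalar product). A symplectic structure is an even, non-degenerate, skew-supersymmetric ($\omega(X,Y)=-(-1)^{xy}\omega(Y,X)$) bilinear form with $(-1)^{xz}\omega(X,[Y,Z])+(-1)^{yx}\omega(Y,[Z,X])+(-1)^{zy}\omega(Z,[X,Y])=0$. A quadratic symplectic Lie superalgebra carries both. An even superderivation is a degree-preserving linear map $D$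 with $D([X,Y])=[D(X),Y]+[X,D(Y)]$; it is skew-supersymmetric if $B(D(X),Y)=-B(X,D(Y))$. Two quadratic Lie superalgebras are i-isomorphic if there is a Lie superalgebra isomorphism between them preserving the invariant scalar products. $E^{i,j}$ denotes the matrix unit with $1$ in position $(i,j)$. Brackets and values of forms on basis vectors not listed and not determined by (skew-)supersymmetry are zero. Double extension of $(\mathfrak{a},B)$ by $(\mathbb{K}e)_{\bar 0}$ by means of an even skew-supersymmetric superderivation $D$: $\mathfrak{g}=\mathbb{K}e\oplus\mathfrak{a}\oplus\mathbb{K}e^*$ with $e,e^*$ even, $[e,X]=D(X)$, $[X,Y]=[X,Y]_{\mathfrak{a}}+B(D(X),Y)e^*$ for $X,Y\in\mathfrak{a}$, $[e^*,\mathfrak{g}]=\{0\}$, and $\widetilde{B}|_{\mathfrak{a}\times\mathfrak{a}}=B$, $\widetilde{B}(e^*,e)=1$, $\widetilde{B}(\mathfrak{a},e)=\widetilde{B}(\mathfrak{a},e^* )=\{0\}$, $\widetilde{B}(e,e)=\widetilde{B}(e^*,e^* )=0$. *)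

theory Defs
  imports "HOL-Analysis.Analysis"
begin

record ('k, 'v) superalgebra =
  scal :: "'k \<Rightarrow> 'v \<Rightarrow> 'v"
  even_part :: "'v set"
  odd_part :: "'v set"
  brk :: "'v \<Rightarrow> 'v \<Rightarrow> 'v"

text \<open>Degrees are natural numbers read modulo 2, so that the signs can be written
  \<open>(- 1) ^ (x * y)\<close>.\<close>

definition homog :: "('k, 'v) superalgebra \<Rightarrow> nat \<Rightarrow> 'v set" where
  "homog L x = (if even x then even_part L else odd_part L)"

definition bilinear_map ::
  "('k::field \<Rightarrow> 'v::ab_group_add \<Rightarrow> 'v) \<Rightarrow> ('k \<Rightarrow> 'w::ab_group_add \<Rightarrow> 'w) \<Rightarrow> ('v \<Rightarrow> 'v \<Rightarrow> 'w) \<Rightarrow> bool"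
  where
  "bilinear_map s t F \<longleftrightarrow>
     (\<forall>X. Vector_Spaces.linear s t (F X)) \<and> (\<forall>Y. Vector_Spaces.linear s t (\<lambda>X. F X Y))"

definition lie_superalgebra :: "('k::field, 'v::ab_group_add) superalgebra \<Rightarrow> bool" where
  "lie_superalgebra L \<longleftrightarrow>
     vector_space (scal L) \<and>
     module.subspace (scal L) (even_part L) \<and>
     module.subspace (scal L) (odd_part L) \<and>
     even_part L \<inter> odd_part L = {0} \<and>
     (\<forall>X. \<exists>X0\<in>even_part L. \<exists>X1\<in>odd_part L. X = X0 + X1) \<and>
     bilinear_map (scal L) (scal L) (brk L) \<and>
     (\<forall>x y. \<forall>X\<in>homog L x. \<forall>Y\<in>homog L y. brk L X Y \<in> homog L (x + y)) \<and>
     (\<forall>x y. \<forall>X\<in>homog L x. \<forall>Y\<in>homog L y.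
        brk L X Y = - scal L ((- 1) ^ (x * y)) (brk L Y X)) \<and>
     (\<forall>x y z. \<forall>X\<in>homog L x. \<forall>Y\<in>homog L y. \<forall>Z\<in>homog L z.
        scal L ((- 1) ^ (x * z)) (brk L X (brk L Y Z)) +
        scal L ((- 1) ^ (x * y)) (brk L Y (brk L Z X)) +
        scal L ((- 1) ^ (y * z)) (brk L Z (brk L X Y)) = 0)"

definition bilinear_form ::
  "('k::field, 'v::ab_group_add) superalgebra \<Rightarrow> ('v \<Rightarrow> 'v \<Rightarrow> 'k) \<Rightarrow> bool" where
  "bilinear_form L F \<longleftrightarrow> bilinear_map (scal L) (*) F"

definition even_form :: "('k::field, 'v::ab_group_add) superalgebra \<Rightarrow> ('v \<Rightarrow> 'v \<Rightarrow> 'k) \<Rightarrow> bool" where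
  "even_form L F \<longleftrightarrow>
     (\<forall>X\<in>even_part L. \<forall>Y\<in>odd_part L. F X Y = 0 \<and> F Y X = 0)"

definition nondegenerate :: "('v::ab_group_add \<Rightarrow> 'v \<Rightarrow> 'k::field) \<Rightarrow> bool" where
  "nondegenerate F \<longleftrightarrow>
     (\<forall>X. (\<forall>Y. F X Y = 0) \<longrightarrow> X = 0) \<and> (\<forall>Y. (\<forall>X. F X Y = 0) \<longrightarrow> Y = 0)"

definition supersymmetric ::
  "('k::field, 'v::ab_group_add) superalgebra \<Rightarrow> ('v \<Rightarrow> 'v \<Rightarrow> 'k) \<Rightarrow> bool" where
  "supersymmetric L F \<longleftrightarrow>
     (\<forall>x y. \<forall>X\<in>homog L x. \<forall>Y\<in>homog L y. F X Y = (- 1) ^ (x * y) * F Y X)"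

definition skew_supersymmetric ::
  "('k::field, 'v::ab_group_add) superalgebra \<Rightarrow> ('v \<Rightarrow> 'v \<Rightarrow> 'k) \<Rightarrow> bool" where
  "skew_supersymmetric L F \<longleftrightarrow>
     (\<forall>x y. \<forall>X\<in>homog L x. \<forall>Y\<in>homog L y. F X Y = - ((- 1) ^ (x * y)) * F Y X)"

definition invariant_form ::
  "('k::field, 'v::ab_group_add) superalgebra \<Rightarrow> ('v \<Rightarrow> 'v \<Rightarrow> 'k) \<Rightarrow> bool" where
  "invariant_form L F \<longleftrightarrow> (\<forall>X Y Z. F (brk L X Y) Z = F X (brk L Y Z))"

definition quadratic ::
  "('k::field, 'v::ab_group_add) superalgebra \<Rightarrow> ('v \<Rightarrow> 'v \<Rightarrow> 'k) \<Rightarrow> bool" where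
  "quadratic L B \<longleftrightarrow> lie_superalgebra L \<and> bilinear_form L B \<and> even_form L B \<and>
     nondegenerate B \<and> supersymmetric L B \<and> invariant_form L B"

definition symplectic_structure ::
  "('k::field, 'v::ab_group_add) superalgebra \<Rightarrow> ('v \<Rightarrow> 'v \<Rightarrow> 'k) \<Rightarrow> bool" where
  "symplectic_structure L \<omega> \<longleftrightarrow> bilinear_form L \<omega> \<and> even_form L \<omega> \<and>
     nondegenerate \<omega> \<and> skew_supersymmetric L \<omega> \<and>
     (\<forall>x y z. \<forall>X\<in>homog L x. \<forall>Y\<in>homog L y. \<forall>Z\<in>homog L z.
        (- 1) ^ (x * z) * \<omega> X (brk L Y Z) +
        (- 1) ^ (y * x) * \<omega> Y (brk L Z X) +
        (- 1) ^ (z * y) * \<omega> Z (brk L X Y) = 0)"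

definition quadratic_symplectic ::
  "('k::field, 'v::ab_group_add) superalgebra \<Rightarrow> ('v \<Rightarrow> 'v \<Rightarrow> 'k) \<Rightarrow> ('v \<Rightarrow> 'v \<Rightarrow> 'k) \<Rightarrow> bool" where
  "quadratic_symplectic L B \<omega> \<longleftrightarrow> quadratic L B \<and> symplectic_structure L \<omega>"

definition even_superderivation ::
  "('k::field, 'v::ab_group_add) superalgebra \<Rightarrow> ('v \<Rightarrow> 'v) \<Rightarrow> bool" where
  "even_superderivation L D \<longleftrightarrow>
     Vector_Spaces.linear (scal L) (scal L) D \<and>
     D ` even_part L \<subseteq> even_part L \<and> D ` odd_part L \<subseteq> odd_part L \<and>
     (\<forall>X Y. D (brk L X Y) = brk L (D X) Y + brk L X (D Y))"

definition skew_supersymmetric_map :: "('v \<Rightarrow> 'v \<Rightarrow> 'k::field) \<Rightarrow> ('v \<Rightarrow> 'v) \<Rightarrow> bool" where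
  "skew_supersymmetric_map B D \<longleftrightarrow> (\<forall>X Y. B (D X) Y = - B X (D Y))"

definition nilpotent_map :: "('v::ab_group_add \<Rightarrow> 'v) \<Rightarrow> bool" where
  "nilpotent_map D \<longleftrightarrow> (\<exists>n. \<forall>X. (D ^^ n) X = 0)"

definition i_isomorphism ::
  "('k::field, 'v::ab_group_add) superalgebra \<Rightarrow> ('v \<Rightarrow> 'v \<Rightarrow> 'k) \<Rightarrow>
   ('k, 'w::ab_group_add) superalgebra \<Rightarrow> ('w \<Rightarrow> 'w \<Rightarrow> 'k) \<Rightarrow> ('v \<Rightarrow> 'w) \<Rightarrow> bool" where
  "i_isomorphism L B L' B' f \<longleftrightarrow>
     Vector_Spaces.linear (scal L) (scal L') f \<and> bij f \<and>
     f ` even_part L = even_part L' \<and> f ` odd_part L = odd_part L' \<and>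
     (\<forall>X Y. f (brk L X Y) = brk L' (f X) (f Y)) \<and>
     (\<forall>X Y. B' (f X) (f Y) = B X Y)"

text \<open>The triple \<open>(\<alpha>, X, \<beta>)\<close> stands for \<open>\<alpha> e + X + \<beta> e\<^sup>*\<close>. As \<open>e\<close> is even,
  \<open>[X, e] = - D X\<close> for all \<open>X\<close> in the algebra being extended.\<close>

definition double_extension ::
  "('k::field, 'v::ab_group_add) superalgebra \<Rightarrow> ('v \<Rightarrow> 'v \<Rightarrow> 'k) \<Rightarrow> ('v \<Rightarrow> 'v) \<Rightarrow>
   ('k, 'k \<times> 'v \<times> 'k) superalgebra" where
  "double_extension L B D =
     \<lparr> scal = (\<lambda>c (\<alpha>, X, \<beta>). (c * \<alpha>, scal L c X, c * \<beta>)),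
       even_part = UNIV \<times> even_part L \<times> UNIV,
       odd_part = {0} \<times> odd_part L \<times> {0},
       brk = (\<lambda>(\<alpha>, X, \<beta>) (\<alpha>', Y, \<beta>').
         (0, scal L \<alpha> (D Y) - scal L \<alpha>' (D X) + brk L X Y, B (D X) Y)) \<rparr>"

definition double_extension_form ::
  "('v \<Rightarrow> 'v \<Rightarrow> 'k::field) \<Rightarrow> ('k \<times> 'v \<times> 'k) \<Rightarrow> ('k \<times> 'v \<times> 'k) \<Rightarrow> 'k" where
  "double_extension_form B = (\<lambda>(\<alpha>, X, \<beta>) (\<alpha>', Y, \<beta>'). B X Y + \<alpha> * \<beta>' + \<beta> * \<alpha>')"

text \<open>The coordinates of \<open>complex ^ 4\<close> are taken in the ordered basis
  \<open>X\<^sub>0, X\<^sub>1\<close> (even), \<open>Y\<^sub>1, Y\<^sub>2\<close> (odd); bracket and form are the bilinear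
  extensions of their values on basis vectors.\<close>

definition g41_X0 :: "complex ^ 4" where "g41_X0 = axis 1 1"
definition g41_X1 :: "complex ^ 4" where "g41_X1 = axis 2 1"
definition g41_Y1 :: "complex ^ 4" where "g41_Y1 = axis 3 1"
definition g41_Y2 :: "complex ^ 4" where "g41_Y2 = axis 4 1"

definition g41 :: "(complex, complex ^ 4) superalgebra" where
  "g41 =
     \<lparr> scal = (*s),
       even_part = {X. X $ 3 = 0 \<and> X $ 4 = 0},
       odd_part = {X. X $ 1 = 0 \<and> X $ 2 = 0},
       brk = (\<lambda>X Y. (X $ 2 * Y $ 3 - X $ 3 * Y $ 2) *s (- 2 *s g41_Y2)
                    + (X $ 3 * Y $ 3) *s (- 2 *s g41_X0)) \<rparr>"

definition g41_form :: "complex ^ 4 \<Rightarrow> complex ^ 4 \<Rightarrow> complex" where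
  "g41_form X Y = X $ 1 * Y $ 2 + X $ 2 * Y $ 1 + X $ 4 * Y $ 3 - X $ 3 * Y $ 4"

text \<open>The coordinates of \<open>complex ^ 6\<close> are taken in the ordered basis
  \<open>X\<^sub>0, X\<^sub>1, e, e\<^sup>*\<close> (even), \<open>Y\<^sub>1, Y\<^sub>2\<close> (odd); bracket and form are the bilinear
  extensions of their values on basis vectors.\<close>

definition fam_X0 :: "complex ^ 6" where "fam_X0 = axis 1 1"
definition fam_X1 :: "complex ^ 6" where "fam_X1 = axis 2 1"
definition fam_e :: "complex ^ 6" where "fam_e = axis 3 1"
definition fam_e_star :: "complex ^ 6" where "fam_e_star = axis 4 1"
definition fam_Y1 :: "complex ^ 6" where "fam_Y1 = axis 5 1"
definition fam_Y2 :: "complex ^ 6" where "fam_Y2 = axis 6 1"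

definition fam :: "complex \<Rightarrow> (complex, complex ^ 6) superalgebra" where
  "fam b\<^sub>2 =
     \<lparr> scal = (*s),
       even_part = {X. X $ 5 = 0 \<and> X $ 6 = 0},
       odd_part = {X. X $ 1 = 0 \<and> X $ 2 = 0 \<and> X $ 3 = 0 \<and> X $ 4 = 0},
       brk = (\<lambda>X Y. (X $ 3 * Y $ 5 - X $ 5 * Y $ 3) *s (b\<^sub>2 *s fam_Y2)
                    + (X $ 2 * Y $ 5 - X $ 5 * Y $ 2) *s (- 2 *s fam_Y2)
                    + (X $ 5 * Y $ 5) *s (- 2 *s fam_X0 + b\<^sub>2 *s fam_e_star)) \<rparr>"

definition fam_form :: "complex ^ 6 \<Rightarrow> complex ^ 6 \<Rightarrow> complex" where
  "fam_form X Y = X $ 1 * Y $ 2 + X $ 2 * Y $ 1 + X $ 3 * Y $ 4 + X $ 4 * Y $ 3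
                  + X $ 6 * Y $ 5 - X $ 5 * Y $ 6"

definition matrix_unit :: "'n \<Rightarrow> 'n \<Rightarrow> complex ^ 'n ^ 'n" where
  "matrix_unit i j = (\<chi> k l. if k = i \<and> l = j then 1 else 0)"

text \<open>Scalar multiples of matrices are real ones (\<open>*\<^sub>R\<close>); the coefficients are integers.\<close>

definition fam_delta :: "complex ^ 6 \<Rightarrow> complex ^ 6" where
  "fam_delta X =
     (2 *\<^sub>R matrix_unit 1 1 - 2 *\<^sub>R matrix_unit 2 2 - 2 *\<^sub>R matrix_unit 3 3
      + 2 *\<^sub>R matrix_unit 4 4 + matrix_unit 5 5 - matrix_unit 6 6) *v X"

end

theory Submission
  imports Defs
begin

text \<open>A nilpotent \<open>D\<close> has the form \<open>D Y\<^sub>1 = q Y\<^sub>2\<close> and kills the other basis vectors. The change of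
  basis \<open>X\<^sub>0 \<mapsto> X\<^sub>0 - s e\<^sup>*\<close>, \<open>e \<mapsto> e + s X\<^sub>1\<close> is an isometry and moves the parameter of the family
  from \<open>q\<close> to \<open>q + 2 s\<close>, so the double extension is i-isomorphic to every member of the
  family, whatever \<open>q\<close> is, including \<open>q = 0\<close>. The symplectic structure of the family is then
  pulled back.\<close>

section \<open>Six-dimensional coordinates and general facts on linear maps\<close>

lemma exhaust_6: "x = 1 \<or> x = 2 \<or> x = 3 \<or> x = 4 \<or> x = 5 \<or> x = 6" for x :: 6
proof (induct x)
  case (of_int z)
  \<comment> \<open>The elements of the index type are the residues 0 to 5; the index written 6 is
    the residue 0.\<close>
  then have "z = 0 \<or> z = 1 \<or> z = 2 \<or> z = 3 \<or> z = 4 \<or> z = 5" by auto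
  then show ?case by auto
qed

lemma forall_6: "(\<forall>i::6. P i) \<longleftrightarrow> P 1 \<and> P 2 \<and> P 3 \<and> P 4 \<and> P 5 \<and> P 6"
  by (metis exhaust_6)

lemma UNIV_6: "(UNIV :: 6 set) = {1, 2, 3, 4, 5, 6}"
  using exhaust_6 by auto

lemma sum_6: "sum f (UNIV :: 6 set) = f 1 + f 2 + f 3 + f 4 + f 5 + f 6"
  unfolding UNIV_6 by (simp add: ac_simps)

lemma linear_injD:
  assumes "Vector_Spaces.linear s t f" and "inj f" and "f x = 0"
  shows "x = 0"
proof -
  interpret Vector_Spaces.linear s t f by (fact assms(1))
  show ?thesis using assms(2,3) by (metis injD zero)
qed

lemma i_isomorphism_homog_iff:
  assumes "i_isomorphism L B L' B' f"
  shows "f X \<in> homog L' x \<longleftrightarrow> X \<in> homog L x"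
  using assms unfolding i_isomorphism_def homog_def bij_def
  by (metis inj_image_mem_iff)

text \<open>Iterating gives \<open>(D ^^ n) v = s (c ^ n) v\<close>, so some power of
  \<open>c\<close> vanishes. This will kill the diagonal entries of \<open>D\<close>.\<close>

lemma nilpotent_map_eigenvalue:
  assumes lin: "Vector_Spaces.linear s s D" and "nilpotent_map D"
    and eig: "D v = s c v" and "v \<noteq> 0"
  shows "c = 0"
proof -
  interpret Vector_Spaces.linear s s D by (fact lin)
  have pow: "(D ^^ n) v = s (c ^ n) v" for n
    by (induction n) (simp_all add: scale eig mult.commute)
  obtain n where "(D ^^ n) v = 0"
    using \<open>nilpotent_map D\<close> unfolding nilpotent_map_def by blast
  then show ?thesis using pow \<open>v \<noteq> 0\<close> by simp
qed

section \<open>The target family: quadratic structure, the derivation \<open>fam_delta\<close>,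
  symplectic form\<close>

lemma fam_delta_nth [simp]:
  "fam_delta X $ 1 = 2 * X $ 1" "fam_delta X $ 2 = - 2 * X $ 2"
  "fam_delta X $ 3 = - 2 * X $ 3" "fam_delta X $ 4 = 2 * X $ 4"
  "fam_delta X $ 5 = X $ 5" "fam_delta X $ 6 = - X $ 6"
  by (simp_all add: fam_delta_def matrix_vector_mult_def matrix_unit_def sum_6 scaleR_conv_of_real)

lemma fam_brk_nth [simp]:
  "brk (fam b) X Y $ 1 = - 2 * X $ 5 * Y $ 5"
  "brk (fam b) X Y $ 2 = 0"
  "brk (fam b) X Y $ 3 = 0"
  "brk (fam b) X Y $ 4 = b * X $ 5 * Y $ 5"
  "brk (fam b) X Y $ 5 = 0"
  "brk (fam b) X Y $ 6 =
     b * (X $ 3 * Y $ 5 - X $ 5 * Y $ 3) - 2 * (X $ 2 * Y $ 5 - X $ 5 * Y $ 2)"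
  by (simp_all add: fam_def fam_X0_def fam_Y2_def fam_e_star_def axis_def)

lemma fam_simps [simp]:
  "scal (fam b) = (*s)"
  "even_part (fam b) = {X. X $ 5 = 0 \<and> X $ 6 = 0}"
  "odd_part (fam b) = {X. X $ 1 = 0 \<and> X $ 2 = 0 \<and> X $ 3 = 0 \<and> X $ 4 = 0}"
  by (simp_all add: fam_def)

lemma vector_space_vec: "vector_space ((*s) :: 'a::field \<Rightarrow> 'a ^ 'n \<Rightarrow> 'a ^ 'n)"
  by (fact vec.vector_space_axioms)

lemma vector_space_mult: "vector_space ((*) :: 'a::field \<Rightarrow> 'a \<Rightarrow> 'a)"
  by unfold_locales (simp_all add: algebra_simps)

text \<open>The bracket reads only coordinates 2, 3, 5 and takes values in coordinates 1, 4, 6.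
  Hence all double brackets vanish and the Jacobi identity is trivial for every
  \<open>b\<close>.\<close>

lemma lie_superalgebra_fam: "lie_superalgebra (fam b)"
proof -
  have "\<exists>X0\<in>even_part (fam b). \<exists>X1\<in>odd_part (fam b). X = X0 + X1" for X
  proof (intro bexI)
    show "X = (\<chi> i. if i = 5 \<or> i = 6 then 0 else X $ i) + (\<chi> i. if i = 5 \<or> i = 6 then X $ i else 0)"
      by (simp add: vec_eq_iff)
  qed simp_all
  moreover have "even_part (fam b) \<inter> odd_part (fam b) = {0}"
    by (auto simp: vec_eq_iff forall_6)
  moreover have "bilinear_map (scal (fam b)) (scal (fam b)) (brk (fam b))"
    unfolding bilinear_map_def Vector_Spaces.linear_iff
    by (simp add: vector_space_vec vec_eq_iff forall_6 algebra_simps)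
  moreover have "module.subspace (scal (fam b)) (even_part (fam b))"
    "module.subspace (scal (fam b)) (odd_part (fam b))"
    by (simp_all add: vec.subspace_def)
  ultimately show ?thesis
    unfolding lie_superalgebra_def
    by (auto simp: vector_space_vec homog_def minus_one_power_iff
        vec_eq_iff forall_6 algebra_simps)
qed

lemma quadratic_fam: "quadratic (fam b) fam_form"
proof -
  \<comment> \<open>The disjunction treats the left and right radicals at once. The form pairs
    coordinates 1 with 2, 3 with 4 and 5 with 6, so testing against basis vectors isolates each
    coordinate up to sign.\<close>
  have nd: "X = 0" if "\<And>Y. fam_form X Y = 0 \<or> fam_form Y X = 0" for X
    using that[of "axis 1 1"] that[of "axis 2 1"] that[of "axis 3 1"]
      that[of "axis 4 1"] that[of "axis 5 1"] that[of "axis 6 1"]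
    by (simp add: fam_form_def axis_def vec_eq_iff forall_6)
  show ?thesis
    unfolding quadratic_def bilinear_form_def even_form_def nondegenerate_def
      supersymmetric_def invariant_form_def bilinear_map_def Vector_Spaces.linear_iff
    using nd lie_superalgebra_fam
    by (auto simp: vector_space_vec vector_space_mult homog_def minus_one_power_iff
        fam_form_def algebra_simps)
qed

text \<open>The eigenvalues add along each bracket: -2 + 1 = -1 for \<open>[e, Y1]\<close> and
  \<open>[X1, Y1]\<close>, and 1 + 1 = 2 for \<open>[Y1, Y1]\<close>, whose terms in
  \<open>X0\<close> and \<open>e*\<close> both have eigenvalue 2.\<close>

lemma even_superderivation_fam_delta: "even_superderivation (fam b) fam_delta"
  unfolding even_superderivation_def Vector_Spaces.linear_iff
  by (auto simp: vector_space_vec vec_eq_iff forall_6 algebra_simps)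

lemma bij_fam_delta: "bij fam_delta"
proof (rule bijI)
  show "inj fam_delta"
    by (rule injI) (simp add: vec_eq_iff forall_6)
  have "Y = fam_delta (\<chi> i. if i = 1 \<or> i = 4 then Y $ i / 2
          else if i = 2 \<or> i = 3 then - Y $ i / 2 else if i = 5 then Y $ i else - Y $ i)" for Y
    by (simp add: vec_eq_iff forall_6)
  then show "surj fam_delta" by (rule surjI[OF sym])
qed

text \<open>Basis vectors that pair nontrivially have opposite eigenvalues.\<close>

lemma skew_supersymmetric_map_fam_delta: "skew_supersymmetric_map fam_form fam_delta"
  by (simp add: skew_supersymmetric_map_def fam_form_def algebra_simps)

text \<open>Conceptually, nondegeneracy reflects the invertibility of \<open>fam_delta\<close>,
  skew-supersymmetry its skewness, and the cyclic identity the derivation rule combined with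
  invariance. The verification is in coordinates.\<close>

lemma quadratic_symplectic_fam:
  "quadratic_symplectic (fam b) fam_form (\<lambda>X Y. fam_form (fam_delta X) Y)"
proof -
  have nd: "X = 0" if "\<And>Y. fam_form (fam_delta X) Y = 0 \<or> fam_form (fam_delta Y) X = 0" for X
    using that[of "axis 1 1"] that[of "axis 2 1"] that[of "axis 3 1"]
      that[of "axis 4 1"] that[of "axis 5 1"] that[of "axis 6 1"]
    by (simp add: fam_form_def axis_def vec_eq_iff forall_6)
  show ?thesis
    unfolding quadratic_symplectic_def symplectic_structure_def bilinear_form_def
      even_form_def nondegenerate_def skew_supersymmetric_def bilinear_map_def
      Vector_Spaces.linear_iff
    using nd quadratic_fam
    by (auto simp: vector_space_vec vector_space_mult homog_def minus_one_power_iff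
        fam_form_def algebra_simps)
qed

section \<open>Transport of structures backwards along an i-isomorphism\<close>

lemma nondegenerate_pullback:
  assumes "nondegenerate F" and "Vector_Spaces.linear s t f" and "bij f"
  shows "nondegenerate (\<lambda>X Y. F (f X) (f Y))"
  unfolding nondegenerate_def
  using assms linear_injD[OF assms(2)]
  by (metis bij_def nondegenerate_def surjD)

lemma bilinear_map_pullback:
  assumes "bilinear_map t u F" and "Vector_Spaces.linear s t f"
  shows "bilinear_map s u (\<lambda>X Y. F (f X) (f Y))"
  using assms unfolding bilinear_map_def Vector_Spaces.linear_iff by simp

text \<open>Each axiom of \<open>L\<close> is the preimage under \<open>f\<close> of the same axiom
  of \<open>L'\<close>; the vector space axioms of \<open>L\<close> are part of the linearity of
  \<open>f\<close>. For the double extension this replaces a direct check of the Jacobi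
  identity.\<close>

lemma lie_superalgebra_pullback:
  assumes lie: "lie_superalgebra L'" and iso: "i_isomorphism L B L' B' f"
  shows "lie_superalgebra L"
proof -
  have lin: "Vector_Spaces.linear (scal L) (scal L') f" and bij: "bij f"
    and brk: "\<And>X Y. f (brk L X Y) = brk L' (f X) (f Y)"
    using iso by (simp_all add: i_isomorphism_def)
  interpret f: Vector_Spaces.linear "scal L" "scal L'" f by (fact lin)
  \<comment> \<open>Injectivity allows every identity in \<open>L\<close> to be tested after
    applying \<open>f\<close>.\<close>
  have eq: "X = Y \<longleftrightarrow> f X = f Y" for X Y
    using bij by (simp add: bij_def inj_eq)
  have ev: "X \<in> even_part L \<longleftrightarrow> f X \<in> even_part L'"
    and od: "X \<in> odd_part L \<longleftrightarrow> f X \<in> odd_part L'" for X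
    using i_isomorphism_homog_iff[OF iso, of X 0] i_isomorphism_homog_iff[OF iso, of X 1]
    by (simp_all add: homog_def)
  have hom: "X \<in> homog L x \<longleftrightarrow> f X \<in> homog L' x" for X x
    using i_isomorphism_homog_iff[OF iso] by simp
  have L'_split: "\<forall>Y. \<exists>Y0\<in>even_part L'. \<exists>Y1\<in>odd_part L'. Y = Y0 + Y1"
    and L'_inter: "even_part L' \<inter> odd_part L' = {0}"
    and L'_bil: "bilinear_map (scal L') (scal L') (brk L')"
    and L'_sub: "f.vs2.subspace (even_part L')" "f.vs2.subspace (odd_part L')"
    and L'_grade: "\<forall>x y. \<forall>X\<in>homog L' x. \<forall>Y\<in>homog L' y. brk L' X Y \<in> homog L' (x + y)"
    and L'_skew: "\<forall>x y. \<forall>X\<in>homog L' x. \<forall>Y\<in>homog L' y.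
        brk L' X Y = - scal L' ((- 1) ^ (x * y)) (brk L' Y X)"
    and L'_jacobi: "\<forall>x y z. \<forall>X\<in>homog L' x. \<forall>Y\<in>homog L' y. \<forall>Z\<in>homog L' z.
        scal L' ((- 1) ^ (x * z)) (brk L' X (brk L' Y Z)) +
        scal L' ((- 1) ^ (x * y)) (brk L' Y (brk L' Z X)) +
        scal L' ((- 1) ^ (y * z)) (brk L' Z (brk L' X Y)) = 0"
    using lie unfolding lie_superalgebra_def by - (elim conjE, assumption)+
  have bil: "bilinear_map (scal L) (scal L) (brk L)"
    using L'_bil f.linear_axioms unfolding bilinear_map_def Vector_Spaces.linear_iff
    by (simp add: eq[of "brk L _ _"] brk f.add f.scale)
  have split: "\<exists>X0\<in>even_part L. \<exists>X1\<in>odd_part L. X = X0 + X1" for X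
  proof -
    obtain Y0 Y1 where Y: "Y0 \<in> even_part L'" "Y1 \<in> odd_part L'" "f X = Y0 + Y1"
      using L'_split by blast
    obtain X0 X1 where "Y0 = f X0" "Y1 = f X1"
      using bij by (metis bij_def surjD)
    with Y have "X0 \<in> even_part L" "X1 \<in> odd_part L" "f X = f (X0 + X1)"
      by (simp_all add: ev od f.add)
    then show ?thesis using eq by blast
  qed
  have inter: "even_part L \<inter> odd_part L = {0}"
  proof -
    have "X \<in> even_part L \<inter> odd_part L \<longleftrightarrow> f X \<in> even_part L' \<inter> odd_part L'" for X
      by (simp add: ev od)
    moreover have "f X \<in> even_part L' \<inter> odd_part L' \<longleftrightarrow> X = 0" for X
      using L'_inter eq[of X 0] by simp
    ultimately show ?thesis by blast
  qed
  have sub: "module.subspace (scal L) (even_part L)" "module.subspace (scal L) (odd_part L)"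
    using L'_sub unfolding f.vs1.subspace_def f.vs2.subspace_def
    by (simp_all add: ev od f.add f.scale)
  show ?thesis
    unfolding lie_superalgebra_def
  proof (intro conjI allI ballI)
    fix x y X Y assume XY: "X \<in> homog L x" "Y \<in> homog L y"
    then show "brk L X Y \<in> homog L (x + y)"
      using L'_grade by (simp only: hom brk)
    have "f (brk L X Y) = f (- scal L ((- 1) ^ (x * y)) (brk L Y X))"
      using XY L'_skew unfolding f.neg f.scale brk hom by blast
    then show "brk L X Y = - scal L ((- 1) ^ (x * y)) (brk L Y X)"
      using eq by blast
    fix z Z assume Z: "Z \<in> homog L z"
    have "f (scal L ((- 1) ^ (x * z)) (brk L X (brk L Y Z)) +
        scal L ((- 1) ^ (x * y)) (brk L Y (brk L Z X)) +
        scal L ((- 1) ^ (y * z)) (brk L Z (brk L X Y))) = f 0"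
      using XY Z L'_jacobi unfolding f.zero f.add f.scale brk hom by blast
    then show "scal L ((- 1) ^ (x * z)) (brk L X (brk L Y Z)) +
        scal L ((- 1) ^ (x * y)) (brk L Y (brk L Z X)) +
        scal L ((- 1) ^ (y * z)) (brk L Z (brk L X Y)) = 0"
      using eq by blast
  qed (fact f.vs1.vector_space_axioms sub inter split bil)+
qed

lemma quadratic_pullback:
  assumes Q: "quadratic L' B'" and iso: "i_isomorphism L B L' B' f"
  shows "quadratic L B"
proof -
  have lin: "Vector_Spaces.linear (scal L) (scal L') f" and bij: "bij f"
    and brk: "\<And>X Y. f (brk L X Y) = brk L' (f X) (f Y)"
    \<comment> \<open>By extensionality, the isometry clause makes \<open>B\<close> the pullback of
      \<open>B'\<close>.\<close>
    and B: "B = (\<lambda>X Y. B' (f X) (f Y))"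
    using iso by (simp_all add: i_isomorphism_def)
  have hom: "X \<in> homog L x \<longleftrightarrow> f X \<in> homog L' x" for X x
    using i_isomorphism_homog_iff[OF iso] by simp
  have "lie_superalgebra L" using Q iso lie_superalgebra_pullback
    by (metis quadratic_def)
  moreover have "nondegenerate B" "bilinear_form L B"
    using Q lin bij unfolding B quadratic_def bilinear_form_def
    by (blast intro: nondegenerate_pullback bilinear_map_pullback)+
  moreover have "even_form L B"
    using Q iso unfolding B quadratic_def even_form_def i_isomorphism_def by blast
  moreover have "supersymmetric L B" "invariant_form L B"
    using Q unfolding B quadratic_def supersymmetric_def invariant_form_def Ball_def hom brk by blast+
  ultimately show ?thesis
    by (simp only: quadratic_def)
qed

lemma quadratic_symplectic_pullback:
  assumes QS: "quadratic_symplectic L' B' \<omega>" and iso: "i_isomorphism L B L' B' f"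
  shows "quadratic_symplectic L B (\<lambda>X Y. \<omega> (f X) (f Y))"
proof -
  have lin: "Vector_Spaces.linear (scal L) (scal L') f" and bij: "bij f"
    and brk: "\<And>X Y. f (brk L X Y) = brk L' (f X) (f Y)"
    using iso by (simp_all add: i_isomorphism_def)
  have hom: "X \<in> homog L x \<longleftrightarrow> f X \<in> homog L' x" for X x
    using i_isomorphism_homog_iff[OF iso] by simp
  have S: "symplectic_structure L' \<omega>" and Q: "quadratic L B"
    using QS quadratic_pullback[OF _ iso] by (simp_all add: quadratic_symplectic_def)
  have "nondegenerate (\<lambda>X Y. \<omega> (f X) (f Y))" "bilinear_form L (\<lambda>X Y. \<omega> (f X) (f Y))"
    using S lin bij unfolding symplectic_structure_def bilinear_form_def
    by (blast intro: nondegenerate_pullback bilinear_map_pullback)+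
  moreover have "even_form L (\<lambda>X Y. \<omega> (f X) (f Y))"
    using S iso unfolding symplectic_structure_def even_form_def i_isomorphism_def by blast
  moreover have "skew_supersymmetric L (\<lambda>X Y. \<omega> (f X) (f Y))"
    using S unfolding symplectic_structure_def skew_supersymmetric_def Ball_def hom by blast
  ultimately show ?thesis
    using S Q unfolding quadratic_symplectic_def symplectic_structure_def Ball_def hom brk by blast
qed

section \<open>Nilpotent skew superderivations of \<open>g41\<close>\<close>

lemma g41_simps [simp]:
  "scal g41 = (*s)"
  "even_part g41 = {X. X $ 3 = 0 \<and> X $ 4 = 0}"
  "odd_part g41 = {X. X $ 1 = 0 \<and> X $ 2 = 0}"
  by (simp_all add: g41_def)

lemma g41_brk_nth [simp]:
  "brk g41 X Y $ 1 = - 2 * X $ 3 * Y $ 3"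
  "brk g41 X Y $ 2 = 0"
  "brk g41 X Y $ 3 = 0"
  "brk g41 X Y $ 4 = - 2 * (X $ 2 * Y $ 3 - X $ 3 * Y $ 2)"
  by (simp_all add: g41_def g41_X0_def g41_Y2_def axis_def)

lemma g41_basis_nth [simp]:
  "g41_X0 $ 1 = 1" "g41_X0 $ 2 = 0" "g41_X0 $ 3 = 0" "g41_X0 $ 4 = 0"
  "g41_X1 $ 1 = 0" "g41_X1 $ 2 = 1" "g41_X1 $ 3 = 0" "g41_X1 $ 4 = 0"
  "g41_Y1 $ 1 = 0" "g41_Y1 $ 2 = 0" "g41_Y1 $ 3 = 1" "g41_Y1 $ 4 = 0"
  "g41_Y2 $ 1 = 0" "g41_Y2 $ 2 = 0" "g41_Y2 $ 3 = 0" "g41_Y2 $ 4 = 1"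
  by (simp_all add: g41_X0_def g41_X1_def g41_Y1_def g41_Y2_def axis_def)

text \<open>Evenness and skewness make \<open>g41_X0\<close> and \<open>g41_X1\<close> eigenvectors,
  the bracket \<open>[X1, Y1]\<close> does the same for \<open>g41_Y2\<close>, and nilpotency
  annihilates all eigenvalues. Only the \<open>Y2\<close> component of \<open>D g41_Y1\<close>
  survives.\<close>

lemma g41_nilpotent_superderivation:
  assumes der: "even_superderivation g41 D"
    and skew: "skew_supersymmetric_map g41_form D"
    and nil: "nilpotent_map D"
  obtains q where "D = (\<lambda>X. (q * X $ 3) *s g41_Y2)"
proof -
  have lin: "Vector_Spaces.linear (*s) (*s) D"
    and ev: "\<And>X. X $ 3 = 0 \<Longrightarrow> X $ 4 = 0 \<Longrightarrow> D X $ 3 = 0 \<and> D X $ 4 = 0"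
    and od: "\<And>X. X $ 1 = 0 \<Longrightarrow> X $ 2 = 0 \<Longrightarrow> D X $ 1 = 0 \<and> D X $ 2 = 0"
    and brk: "\<And>X Y. D (brk g41 X Y) = brk g41 (D X) Y + brk g41 X (D Y)"
    using der by (auto simp: even_superderivation_def)
  have skew': "g41_form (D X) Y = - g41_form X (D Y)" for X Y
    using skew by (simp add: skew_supersymmetric_map_def)
  interpret D: Vector_Spaces.linear "(*s)" "(*s)" D by (fact lin)
  \<comment> \<open>One nonzero coordinate certifies that \<open>v\<close> is nonzero.\<close>
  have eig: "c = 0" if "D v = c *s v" "v $ i \<noteq> 0" for c v i
    using nilpotent_map_eigenvalue[OF lin nil that(1)] that(2) by (metis zero_index)
  \<comment> \<open>Skewness on the pair \<open>g41_X0\<close>, \<open>g41_X0\<close> forces the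
    second coordinate to equal its negative.\<close>
  have eX0: "D g41_X0 = (D g41_X0 $ 1) *s g41_X0"
    using ev[of g41_X0] skew'[of g41_X0 g41_X0]
    by (simp add: vec_eq_iff forall_4 g41_form_def)
  have X0: "D g41_X0 = 0" using eig[OF eX0, of 1] eX0 by simp
  have eX1: "D g41_X1 = (D g41_X1 $ 2) *s g41_X1"
    using ev[of g41_X1] skew'[of g41_X1 g41_X1]
    by (simp add: vec_eq_iff forall_4 g41_form_def)
  have X1: "D g41_X1 = 0" using eig[OF eX1, of 2] eX1 by simp
  have brk0: "brk g41 0 Z = 0" for Z
    by (simp add: vec_eq_iff forall_4)
  have "brk g41 g41_X1 g41_Y1 = - 2 *s g41_Y2"
    by (simp add: vec_eq_iff forall_4)
  \<comment> \<open>The derivation rule on \<open>[X1, Y1]\<close> keeps one term, since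
    \<open>D g41_X1 = 0\<close>.\<close>
  then have "- 2 *s D g41_Y2 = brk g41 g41_X1 (D g41_Y1)"
    using brk[of g41_X1 g41_Y1] D.scale[of "- 2" g41_Y2]
    by (metis X1 brk0 add_0)
  then have eY2: "D g41_Y2 = (D g41_Y1 $ 3) *s g41_Y2"
    by (simp add: vec_eq_iff forall_4)
  \<comment> \<open>The \<open>Y1\<close> coordinate of \<open>D g41_Y1\<close> has just appeared as
    the eigenvalue at \<open>g41_Y2\<close>.\<close>
  have p: "D g41_Y1 $ 3 = 0" using eig[OF eY2, of 4] by simp
  then have Y2: "D g41_Y2 = 0" using eY2 by simp
  have Y1: "D g41_Y1 = (D g41_Y1 $ 4) *s g41_Y2"
    using od[of g41_Y1] p by (simp add: vec_eq_iff forall_4)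
  have "D X = (D g41_Y1 $ 4 * X $ 3) *s g41_Y2" for X
  proof -
    have "X = X $ 1 *s g41_X0 + X $ 2 *s g41_X1 + X $ 3 *s g41_Y1 + X $ 4 *s g41_Y2"
      by (simp add: vec_eq_iff forall_4)
    then have "D X = D (X $ 1 *s g41_X0 + X $ 2 *s g41_X1 + X $ 3 *s g41_Y1 + X $ 4 *s g41_Y2)"
      by (rule arg_cong)
    also have "\<dots> = X $ 3 *s D g41_Y1"
      by (simp add: D.add D.scale X0 X1 Y2)
    also have "\<dots> = (D g41_Y1 $ 4 * X $ 3) *s g41_Y2"
      by (subst Y1) (simp add: mult.commute)
    finally show ?thesis .
  qed
  then show ?thesis using that by blast
qed

text \<open>The parameter \<open>b\<close> is arbitrary and independent of \<open>q\<close>: a shear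
  mixing \<open>e\<close> with \<open>X1\<close> absorbs the difference.\<close>

lemma double_extension_g41_i_isomorphic:
  assumes D: "D = (\<lambda>X. (q * X $ 3) *s g41_Y2)"
  shows "\<exists>f. i_isomorphism (double_extension g41 g41_form D) (double_extension_form g41_form)
               (fam b) fam_form f"
proof -
  \<comment> \<open>Forced by \<open>[e + s X1, Y1] = (b - 2 s) Y2\<close> in the family, which must
    equal the image \<open>q Y2\<close> of \<open>[e, Y1]\<close>.\<close>
  define s where "s = (b - q) / 2"
  have b: "b = q + 2 * s" by (simp add: s_def field_simps)
  \<comment> \<open>Here \<open>e\<close> goes to \<open>e + s X1\<close>; sending \<open>X0\<close>
    to \<open>X0 - s e*\<close> keeps the images of \<open>e\<close> and \<open>X0\<close>
    orthogonal.\<close>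
  define f :: "complex \<times> (complex ^ 4) \<times> complex \<Rightarrow> complex ^ 6" where
    "f = (\<lambda>(\<alpha>, X, \<beta>). \<chi> i. if i = 1 then X $ 1 else if i = 2 then X $ 2 + s * \<alpha>
       else if i = 3 then \<alpha> else if i = 4 then \<beta> - s * X $ 1 else if i = 5 then X $ 3 else X $ 4)"
  \<comment> \<open>The inverse of \<open>f\<close>, obtained by reversing both shears.\<close>
  define g :: "complex ^ 6 \<Rightarrow> complex \<times> (complex ^ 4) \<times> complex" where
    "g = (\<lambda>Z. (Z $ 3, \<chi> i. if i = 1 then Z $ 1 else if i = 2 then Z $ 2 - s * Z $ 3
       else if i = 3 then Z $ 5 else Z $ 6, Z $ 4 + s * Z $ 1))"
  have f_nth [simp]: "f (\<alpha>, X, \<beta>) $ 1 = X $ 1" "f (\<alpha>, X, \<beta>) $ 2 = X $ 2 + s * \<alpha>"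
    "f (\<alpha>, X, \<beta>) $ 3 = \<alpha>" "f (\<alpha>, X, \<beta>) $ 4 = \<beta> - s * X $ 1"
    "f (\<alpha>, X, \<beta>) $ 5 = X $ 3" "f (\<alpha>, X, \<beta>) $ 6 = X $ 4" for \<alpha> X \<beta>
    by (simp_all add: f_def)
  have gf: "g (f V) = V" for V
    by (cases V) (simp add: g_def vec_eq_iff forall_4)
  have fg: "f (g Z) = Z" for Z
    by (simp add: f_def g_def vec_eq_iff forall_6)
  let ?G = "double_extension g41 g41_form D"
  have vs: "vector_space (scal ?G)"
    by unfold_locales (auto simp: double_extension_def vec_eq_iff forall_4 algebra_simps)
  have lin: "Vector_Spaces.linear (scal ?G) (scal (fam b)) f"
    unfolding Vector_Spaces.linear_iff
    using vs by (auto simp: double_extension_def vector_space_vec vec_eq_iff forall_6 algebra_simps)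
  have "f V \<in> even_part (fam b) \<longleftrightarrow> V \<in> even_part ?G" for V
    by (cases V) (simp add: double_extension_def)
  then have ev: "f ` even_part ?G = even_part (fam b)"
    using fg by (metis image_eqI image_subsetI subsetI subset_antisym)
  have "f V \<in> odd_part (fam b) \<longleftrightarrow> V \<in> odd_part ?G" for V
    by (cases V) (auto simp: double_extension_def)
  then have od: "f ` odd_part ?G = odd_part (fam b)"
    using fg by (metis image_eqI image_subsetI subsetI subset_antisym)
  have brk: "f (brk ?G V W) = brk (fam b) (f V) (f W)" for V W
    by (cases V; cases W)
      (simp add: double_extension_def D g41_form_def b vec_eq_iff forall_6 algebra_simps)
  have form: "fam_form (f V) (f W) = double_extension_form g41_form V W" for V W
    by (cases V; cases W)
      (simp add: double_extension_form_def fam_form_def g41_form_def algebra_simps)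
  have "bij f" using gf fg by (metis bijI injI surjI)
  then have "i_isomorphism ?G (double_extension_form g41_form) (fam b) fam_form f"
    using lin ev od brk form unfolding i_isomorphism_def by blast
  then show ?thesis by blast
qed

theorem proposition4p3:
  fixes \<omega> :: "complex ^ 4 \<Rightarrow> complex ^ 4 \<Rightarrow> complex"
    and b\<^sub>1' b\<^sub>2' :: complex
    and D :: "complex ^ 4 \<Rightarrow> complex ^ 4"
  assumes "quadratic_symplectic g41 g41_form \<omega>"
    and "\<omega> g41_X0 g41_X1 = 2 * b\<^sub>1'"
    and "\<omega> g41_Y2 g41_Y1 = - b\<^sub>1'"
    and "\<omega> g41_Y1 g41_Y1 = b\<^sub>2'"
    and "\<omega> g41_Y2 g41_Y2 = 0"
    and "b\<^sub>1' \<noteq> 0"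
    and "even_superderivation g41 D"
    and "skew_supersymmetric_map g41_form D"
    and "nilpotent_map D"
  defines "G \<equiv> double_extension g41 g41_form D"
    and "Bt \<equiv> double_extension_form g41_form"
  shows "\<exists>\<omega>t b\<^sub>2 f.
      quadratic_symplectic G Bt \<omega>t \<and>
      b\<^sub>2 \<noteq> 0 \<and> i_isomorphism G Bt (fam b\<^sub>2) fam_form f \<and>
      even_superderivation (fam b\<^sub>2) fam_delta \<and> bij fam_delta \<and>
      skew_supersymmetric_map fam_form fam_delta \<and>
      quadratic_symplectic (fam b\<^sub>2) fam_form (\<lambda>X Y. fam_form (fam_delta X) Y) \<and>
      (\<forall>X Y. \<omega>t X Y = fam_form (fam_delta (f X)) (f Y))"
proof -
  obtain q where "D = (\<lambda>X. (q * X $ 3) *s g41_Y2)"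
    using assms(7-9) by (rule g41_nilpotent_superderivation)
  \<comment> \<open>Every parameter is reachable, so 1 serves as a nonzero one, also when
    \<open>q = 0\<close>.\<close>
  then obtain f where iso: "i_isomorphism G Bt (fam 1) fam_form f"
    unfolding G_def Bt_def using double_extension_g41_i_isomorphic by blast
  \<comment> \<open>As \<open>f\<close> is an isometry, this form corresponds to the conjugate of
    \<open>fam_delta\<close> by \<open>f\<close>.\<close>
  have "quadratic_symplectic G Bt (\<lambda>X Y. fam_form (fam_delta (f X)) (f Y))"
    using quadratic_symplectic_pullback[OF quadratic_symplectic_fam iso] .
  then show ?thesis
    using iso even_superderivation_fam_delta bij_fam_delta skew_supersymmetric_map_fam_delta
      quadratic_symplectic_fam zero_neq_one
    by metis
qed

end
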